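(* Let $b\ge 2$ and $\rho\ge 1$ be integers. Let $\overline{C}_b^\rho(n)$, $n\ge 0$, be the number of $\rho$-color $b$-ary partitions of $n$ in which the multiplicity of each part with color $i$ is a multiple of $i$. Then for all integers $n\ge 0$, $$\sum_{j=0}^{\rho(\rho+1)/2}T(\rho,j)\,\overline{C}_b^\rho(bn-j)=\overline{C}_b^\rho(n),$$ $$\sum_{j=0}^{\rho(\rho+1)/2}T(\rho,j)\,\overline{C}_b^\rho(bn+r-j)=0\qquad(1\le r\le b-1),$$ where $\overline{C}_b^\rho(m)=0$ for $m<0$, and where the coefficients $T(\rho,j)$ are defined by $\prod_{i=1}^\rho(1-q^i)=\sum_{j=0}^{\rho(\rho+1)/2}T(\rho,j)q^j$.
   Context: A $\rho$-color $b$-ary partition of $n$ is a finite multiset of colored parts, each being a power $b^j$ ($j\ge0$) with a color $i\in\{1,\dots,\rho\}$, with sum $n$ (order irrelevant). The condition means that for every $j\ge 0$ and every $i$ the number of occurrences of the colored part $(b^j,i)$ is a (possibly zero) multiple of $i$; $\overline{C}_b^\rho(0)=1$. Equivalently, $\sum_{n\ge0}\overline{C}_b^\rho(n)q^n=\prod_{j=0}^\infty\prod_{i=1}^\rho\frac{1}{1-q^{ib^j}}$. *)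

theory Defs
  imports "HOL-Library.Multiset" "HOL-Computational_Algebra.Polynomial"
begin

text \<open>A colored part is a pair of its size and its color.\<close>

definition bary_partitions :: "nat \<Rightarrow> nat \<Rightarrow> nat \<Rightarrow> (nat \<times> nat) multiset set" where
  "bary_partitions b \<rho> n =
     {M. set_mset M \<subseteq> range (\<lambda>j. b ^ j) \<times> {1..\<rho>} \<and> (\<Sum>p\<in>#M. fst p) = n}"

definition C_partitions :: "nat \<Rightarrow> nat \<Rightarrow> nat \<Rightarrow> (nat \<times> nat) multiset set" where
  "C_partitions b \<rho> n =
     {M \<in> bary_partitions b \<rho> n. \<forall>j. \<forall>i\<in>{1..\<rho>}. i dvd count M (b ^ j, i)}"

text \<open>The argument is an integer so that the function can be extended by zero to negative
  arguments. The cardinality is that of a finite set by the lemma below.\<close>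

definition Cbar :: "nat \<Rightarrow> nat \<Rightarrow> int \<Rightarrow> nat" where
  "Cbar b \<rho> m = (if m < 0 then 0 else card (C_partitions b \<rho> (nat m)))"

definition T :: "nat \<Rightarrow> nat \<Rightarrow> int" where
  "T \<rho> j = coeff (\<Prod>i=1..\<rho>. 1 - monom 1 i) j"

lemma finite_C_partitions:
  assumes "b \<ge> 2"
  shows "finite (C_partitions b \<rho> n)"
proof -
  have "C_partitions b \<rho> n \<subseteq> (\<Union>k\<le>n. multisets_of_size ({..n} \<times> {..\<rho>}) k)"
  proof
    fix M assume "M \<in> C_partitions b \<rho> n"
    hence sub: "set_mset M \<subseteq> range (\<lambda>j. b ^ j) \<times> {1..\<rho>}" and s: "(\<Sum>p\<in>#M. fst p) = n"
      by (auto simp: C_partitions_def bary_partitions_def)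
    have "(\<Sum>p\<in>#M. 1) \<le> (\<Sum>p\<in>#M. fst p)"
      by (rule sum_mset_mono) (use sub assms in \<open>fastforce simp: Suc_le_eq\<close>)
    hence "size M \<le> n" using s by simp
    moreover have "fst p \<le> n" if "p \<in># M" for p
      using that s by (metis insert_DiffM sum_mset.insert image_mset_add_mset le_add1)
    hence "set_mset M \<subseteq> {..n} \<times> {..\<rho>}" using sub by fastforce
    ultimately show "M \<in> (\<Union>k\<le>n. multisets_of_size ({..n} \<times> {..\<rho>}) k)"
      by (auto simp: multisets_of_size_def)
  qed
  thus ?thesis by (rule finite_subset) auto
qed

end

theory Submission
  imports Defs "HOL-Computational_Algebra.Polynomial_FPS"
begin

text \<open>
  Write $C(q)$ for the generating function of the partitions in question. The factors
  $1/(1-q^i)$ of its product formula that belong to the parts of size $1$ can be cancelled one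
  color at a time. Let $D_k(q)$ count the partitions in which the parts of size $1$ have colors
  at most $k$, so that $D_\rho = C$. Such a partition either avoids the part $(1,k)$, or contains it
  at least $k$ times by the divisibility condition, and then $k$ copies can be taken away. Hence
  $(1-q^k) D_k = D_{k-1}$ (lemma \<open>one_minus_X_power_mult_gf\<close>) and
  $\prod_{i=1}^\rho (1-q^i) \cdot C = D_0$. A partition without parts of size $1$ is a partition all of
  whose part sizes have been multiplied by $b$, so $D_0(q) = C(q^b)$
  (lemmas \<open>card_small_colors_0_mult\<close> and \<open>small_colors_0_not_dvd\<close>). The two claims
  compare the coefficients of $q^{bn+r}$ for $0 \le r < b$ on both sides of
  $\prod_{i=1}^\rho (1-q^i) \cdot C(q) = C(q^b)$.
\<close>

definition small_colors :: "nat \<Rightarrow> nat \<Rightarrow> nat \<Rightarrow> nat \<Rightarrow> (nat \<times> nat) multiset set" where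
  "small_colors b \<rho> k n = {M \<in> C_partitions b \<rho> n. \<forall>i. (1, i) \<in># M \<longrightarrow> i \<le> k}"

definition small_colors_gf :: "nat \<Rightarrow> nat \<Rightarrow> nat \<Rightarrow> int fps" where
  "small_colors_gf b \<rho> k = Abs_fps (\<lambda>n. int (card (small_colors b \<rho> k n)))"

lemma C_partitions_iff:
  "M \<in> C_partitions b \<rho> n \<longleftrightarrow>
     (\<forall>p\<in>#M. (\<exists>j. fst p = b ^ j) \<and> snd p \<in> {1..\<rho>}) \<and> (\<Sum>p\<in>#M. fst p) = n \<and>
     (\<forall>j. \<forall>i\<in>{1..\<rho>}. i dvd count M (b ^ j, i))"
  unfolding C_partitions_def bary_partitions_def by (fastforce simp: subset_iff image_iff)

lemma finite_small_colors: "b \<ge> 2 \<Longrightarrow> finite (small_colors b \<rho> k n)"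
  unfolding small_colors_def using finite_C_partitions by auto

lemma small_colors_all: "small_colors b \<rho> \<rho> n = C_partitions b \<rho> n"
  unfolding small_colors_def by (fastforce simp: C_partitions_iff)

lemma add_unit_parts_in_small_colors:
  assumes "k \<in> {1..\<rho>}" "M \<in> small_colors b \<rho> k n"
  shows "M + replicate_mset k (1, k) \<in> small_colors b \<rho> k (n + k)"
proof -
  have "M \<in> C_partitions b \<rho> n" using assms(2) by (simp add: small_colors_def)
  then have "M + replicate_mset k (1, k) \<in> C_partitions b \<rho> (n + k)"
    using assms(1) unfolding C_partitions_iff by (auto intro: exI[of _ 0])
  then show ?thesis using assms(2) by (auto simp: small_colors_def split: if_splits)
qed

text \<open>
  The multiplicity of \<open>(1, k)\<close> is positive and divisible by \<open>k\<close>, so at least \<open>k\<close> copies are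
  present, and removing exactly \<open>k\<close> of them preserves all divisibility conditions.
\<close>

lemma remove_unit_parts_in_small_colors:
  assumes k: "k \<in> {1..\<rho>}" and M: "M \<in> small_colors b \<rho> k n" and mem: "(1, k) \<in># M"
  obtains M' where "M = M' + replicate_mset k (1, k)" "k \<le> n" "M' \<in> small_colors b \<rho> k (n - k)"
proof -
  have "k dvd count M (b ^ 0, k)"
    using M k unfolding small_colors_def C_partitions_iff by blast
  hence "k \<le> count M (1, k)"
    using mem by (auto intro!: dvd_imp_le)
  hence "replicate_mset k (1, k) \<subseteq># M"
    by (simp add: count_le_replicate_mset_subset_eq)
  then obtain M' where M': "M = M' + replicate_mset k (1, k)"
    by (metis subset_mset.diff_add)
  have "i dvd count M' (b ^ j, i)" if "i \<in> {1..\<rho>}" for i j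
  proof -
    have "i dvd count M (b ^ j, i)"
      using M that unfolding small_colors_def C_partitions_iff by blast
    thus ?thesis
      using M' by (auto split: if_splits)
  qed
  hence "k \<le> n" "M' \<in> small_colors b \<rho> k (n - k)"
    using M unfolding M' small_colors_def C_partitions_iff by auto
  with M' that show ?thesis by blast
qed

text \<open>
  The first summand counts the partitions that avoid the part \<open>(1, Suc k)\<close>, the second one those
  that contain it, by removing \<open>Suc k\<close> copies.
\<close>

lemma card_small_colors_Suc:
  assumes b: "b \<ge> 2" and k: "Suc k \<le> \<rho>"
  shows "card (small_colors b \<rho> (Suc k) n) =
           card (small_colors b \<rho> k n) +
           (if Suc k \<le> n then card (small_colors b \<rho> (Suc k) (n - Suc k)) else 0)"
proof -
  define add where "add = (\<lambda>M. M + replicate_mset (Suc k) (1::nat, Suc k))"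
  define A where "A = (if Suc k \<le> n then add ` small_colors b \<rho> (Suc k) (n - Suc k) else {})"
  have avoid: "small_colors b \<rho> k n = {M \<in> small_colors b \<rho> (Suc k) n. (1, Suc k) \<notin># M}"
    by (fastforce simp: small_colors_def le_Suc_eq)
  have contain: "A = {M \<in> small_colors b \<rho> (Suc k) n. (1, Suc k) \<in># M}"
  proof (intro equalityI subsetI)
    fix M assume "M \<in> A"
    then obtain M' where M': "Suc k \<le> n" "M = add M'" "M' \<in> small_colors b \<rho> (Suc k) (n - Suc k)"
      by (auto simp: A_def split: if_splits)
    with add_unit_parts_in_small_colors[of "Suc k" \<rho> M' b "n - Suc k"] k
    show "M \<in> {M \<in> small_colors b \<rho> (Suc k) n. (1, Suc k) \<in># M}"
      by (auto simp: add_def)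
  next
    fix M assume "M \<in> {M \<in> small_colors b \<rho> (Suc k) n. (1, Suc k) \<in># M}"
    then show "M \<in> A"
      using remove_unit_parts_in_small_colors[of "Suc k" \<rho> M b n] k
      by (auto simp: A_def add_def)
  qed
  have "card (small_colors b \<rho> (Suc k) n) = card (small_colors b \<rho> k n \<union> A)"
    unfolding avoid contain by (rule arg_cong[of _ _ card]) auto
  also have "\<dots> = card (small_colors b \<rho> k n) + card A"
    by (rule card_Un_disjoint) (auto simp: avoid contain finite_small_colors[OF b])
  also have "card A = (if Suc k \<le> n then card (small_colors b \<rho> (Suc k) (n - Suc k)) else 0)"
    by (auto simp: A_def add_def card_image inj_on_def)
  finally show ?thesis .
qed

lemma one_minus_X_power_mult_gf:
  assumes "b \<ge> 2" "Suc k \<le> \<rho>"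
  shows "(1 - fps_X ^ Suc k) * small_colors_gf b \<rho> (Suc k) = small_colors_gf b \<rho> k"
proof (rule fps_ext)
  fix n
  have "fps_nth ((1 - fps_X ^ Suc k) * small_colors_gf b \<rho> (Suc k)) n =
          fps_nth (small_colors_gf b \<rho> (Suc k)) n -
          fps_nth (fps_X ^ Suc k * small_colors_gf b \<rho> (Suc k)) n"
    by (simp only: left_diff_distrib fps_sub_nth mult_1_left)
  then show "fps_nth ((1 - fps_X ^ Suc k) * small_colors_gf b \<rho> (Suc k)) n =
               fps_nth (small_colors_gf b \<rho> k) n"
    using card_small_colors_Suc[OF assms, of n]
    by (auto simp: fps_X_power_mult_nth small_colors_gf_def simp del: power_Suc)
qed

lemma prod_mult_gf:
  assumes "b \<ge> 2" "k \<le> \<rho>"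
  shows "(\<Prod>i=1..k. 1 - fps_X ^ i) * small_colors_gf b \<rho> k = small_colors_gf b \<rho> 0"
  using assms(2)
proof (induction k)
  case (Suc k)
  then show ?case
    using one_minus_X_power_mult_gf[OF assms(1) Suc.prems]
    by (simp add: mult.assoc del: power_Suc)
qed simp

text \<open>
  With no color left for the parts of size \<open>1 = b ^ 0\<close>, such parts cannot occur. All part sizes are then
  divisible by \<open>b\<close>, so that dividing them by \<open>b\<close> gives powers of \<open>b\<close> again.
\<close>

lemma small_colors_0_part:
  assumes "M \<in> small_colors b \<rho> 0 n" "p \<in># M"
  obtains j where "fst p = b ^ Suc j" "snd p \<in> {1..\<rho>}"
proof -
  obtain j where j: "fst p = b ^ j" "snd p \<in> {1..\<rho>}"
    using assms by (auto simp: small_colors_def C_partitions_iff)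
  have "j \<noteq> 0"
  proof
    assume "j = 0"
    then have "(1, snd p) \<in># M" using assms(2) j by (metis power_0 prod.collapse)
    then show False using assms(1) j by (auto simp: small_colors_def)
  qed
  with j that show ?thesis by (metis not0_implies_Suc)
qed

lemma small_colors_0_not_dvd:
  assumes "\<not> b dvd n"
  shows "small_colors b \<rho> 0 n = {}"
proof (rule ccontr)
  assume "small_colors b \<rho> 0 n \<noteq> {}"
  then obtain M where M: "M \<in> small_colors b \<rho> 0 n" by auto
  have "b dvd fst p" if "p \<in># M" for p
    by (rule small_colors_0_part[OF M that]) simp
  then have "b dvd (\<Sum>p\<in>#M. fst p)"
    by (induction M) auto
  with M assms show False by (simp add: small_colors_def C_partitions_iff)
qed

text \<open>
  Multiplying all part sizes by \<open>b\<close> is the bijection: it shifts the multiplicity of \<open>(b ^ j, i)\<close>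
  to \<open>(b ^ Suc j, i)\<close> and leaves none at \<open>(b ^ 0, i)\<close>, and \<open>div b\<close> undoes it because no
  part of size \<open>1\<close> is present in the target.
\<close>

lemma card_small_colors_0_mult:
  assumes b: "b \<ge> 2"
  shows "card (small_colors b \<rho> 0 (b * m)) = card (C_partitions b \<rho> m)"
proof -
  define f where "f = (\<lambda>p::nat \<times> nat. (b * fst p, snd p))"
  have inj: "inj f" using b by (auto simp: inj_def f_def prod_eq_iff)
  have sum_f: "(\<Sum>p\<in>#image_mset f M. fst p) = b * (\<Sum>p\<in>#M. fst p)" for M
    by (simp add: f_def sum_mset_distrib_left image_mset.compositionality comp_def)
  have count_f: "count (image_mset f M) (b ^ Suc j, i) = count M (b ^ j, i)" for M i j
  proof -
    have "f -` {f (b ^ j, i)} = {(b ^ j, i)}"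
      using inj by (auto simp: inj_eq)
    then have "count (image_mset f M) (f (b ^ j, i)) = count M (b ^ j, i)"
      by (cases "(b ^ j, i) \<in># M") (auto simp: count_image_mset not_in_iff)
    then show ?thesis by (simp add: f_def)
  qed
  have no_unit: "(1, i) \<notin># image_mset f M" for M i
    using b by (auto simp: f_def)
  have "bij_betw (image_mset f) (C_partitions b \<rho> m) (small_colors b \<rho> 0 (b * m))"
    unfolding bij_betw_def
  proof (intro conjI equalityI subsetI)
    show "inj_on (image_mset f) (C_partitions b \<rho> m)"
      using multiset.inj_map[OF inj] by (rule inj_on_subset) simp
  next
    fix N assume "N \<in> image_mset f ` C_partitions b \<rho> m"
    then obtain M where N: "N = image_mset f M" and M: "M \<in> C_partitions b \<rho> m" by auto
    have "i dvd count N (b ^ j, i)" if i: "i \<in> {1..\<rho>}" for i j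
    proof (cases j)
      case 0
      have "count N (1, i) = 0" using no_unit[of i M] unfolding N not_in_iff .
      then show ?thesis using 0 by simp
    next
      case (Suc j')
      have "i dvd count M (b ^ j', i)" using M i unfolding C_partitions_iff by blast
      then show ?thesis unfolding N Suc count_f .
    qed
    moreover have "(\<exists>j. fst p = b ^ j) \<and> snd p \<in> {1..\<rho>}" if "p \<in># N" for p
    proof -
      from that obtain p' where p': "p' \<in># M" "p = f p'" by (auto simp: N)
      with M obtain j where "fst p' = b ^ j" "snd p' \<in> {1..\<rho>}"
        by (auto simp: C_partitions_iff)
      then have "fst p = b ^ Suc j" "snd p \<in> {1..\<rho>}" by (simp_all add: p' f_def)
      then show ?thesis by blast
    qed
    moreover have "(\<Sum>p\<in>#N. fst p) = b * m"
      using M sum_f[of M] by (simp add: N C_partitions_iff)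
    moreover have "(1, i) \<notin># N" for i
      using no_unit unfolding N .
    ultimately show "N \<in> small_colors b \<rho> 0 (b * m)"
      by (simp add: small_colors_def C_partitions_iff)
  next
    fix N assume N: "N \<in> small_colors b \<rho> 0 (b * m)"
    define M where "M = image_mset (\<lambda>p. (fst p div b, snd p)) N"
    have "f (fst p div b, snd p) = p" if "p \<in># N" for p
    proof -
      from small_colors_0_part[OF N that] obtain j where "fst p = b ^ Suc j" by blast
      then show ?thesis using b by (simp add: f_def prod_eq_iff)
    qed
    then have "image_mset (\<lambda>p. f (fst p div b, snd p)) N = image_mset (\<lambda>p. p) N"
      by (rule image_mset_cong)
    then have NM: "N = image_mset f M"
      by (simp add: M_def image_mset.compositionality comp_def)
    have "(\<exists>j. fst p = b ^ j) \<and> snd p \<in> {1..\<rho>}" if "p \<in># M" for p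
    proof -
      from that obtain p' where p': "p' \<in># N" "p = (fst p' div b, snd p')"
        by (auto simp: M_def)
      from small_colors_0_part[OF N p'(1)] obtain j
        where "fst p' = b ^ Suc j" "snd p' \<in> {1..\<rho>}" .
      then have "fst p = b ^ j \<and> snd p \<in> {1..\<rho>}" using b p' by simp
      then show ?thesis by blast
    qed
    moreover have "(\<Sum>p\<in>#M. fst p) = m"
      using N sum_f[of M] b by (simp add: NM small_colors_def C_partitions_iff)
    moreover have "i dvd count M (b ^ j, i)" if "i \<in> {1..\<rho>}" for i j
    proof -
      have "i dvd count N (b ^ Suc j, i)"
        using N that unfolding small_colors_def C_partitions_iff by blast
      then show ?thesis unfolding NM count_f .
    qed
    ultimately have "M \<in> C_partitions b \<rho> m" unfolding C_partitions_iff by blast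
    with NM show "N \<in> image_mset f ` C_partitions b \<rho> m" by blast
  qed
  then show ?thesis by (simp add: bij_betw_same_card)
qed

lemma T_eq_0:
  assumes "\<rho> * (\<rho> + 1) div 2 < j"
  shows "T \<rho> j = 0"
proof -
  have "degree (\<Prod>i=1..\<rho>. 1 - monom (1::int) i) \<le> (\<Sum>i=1..\<rho>. degree (1 - monom (1::int) i))"
    using degree_prod_sum_le[of "{1..\<rho>}" "\<lambda>i. 1 - monom (1::int) i"] by (simp add: comp_def)
  also have "\<dots> \<le> (\<Sum>i=1..\<rho>. i)"
    by (intro sum_mono degree_diff_le) (auto simp: degree_monom_eq)
  also have "\<dots> = \<rho> * (\<rho> + 1) div 2"
    using gauss_sum_from_Suc_0[of \<rho>, where 'a = nat] by simp
  finally show ?thesis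
    using assms unfolding T_def by (intro coeff_eq_0) linarith
qed

text \<open>
  The sum is the Cauchy product for \<open>\<Prod>i=1..\<rho>. 1 - fps_X ^ i\<close> and the generating function of
  \<open>Cbar\<close>: cutting it off at the degree of the first factor instead of at \<open>m\<close> makes no
  difference, as \<open>Cbar\<close> vanishes at negative arguments.
\<close>

lemma sum_T_Cbar:
  assumes "b \<ge> 2"
  shows "(\<Sum>j=0..\<rho> * (\<rho> + 1) div 2. T \<rho> j * int (Cbar b \<rho> (int m - int j))) =
           int (card (small_colors b \<rho> 0 m))" (is "sum ?t {0..?d} = _")
proof -
  have "sum ?t {0..?d} = sum ?t {0..max ?d m}"
    by (rule sum.mono_neutral_left) (auto simp: T_eq_0)
  also have "\<dots> = sum ?t {0..m}"
    by (rule sum.mono_neutral_right) (auto simp: Cbar_def)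
  also have "\<dots> = (\<Sum>j=0..m. T \<rho> j * fps_nth (small_colors_gf b \<rho> \<rho>) (m - j))"
    by (rule sum.cong)
       (auto simp: Cbar_def small_colors_gf_def small_colors_all nat_diff_distrib)
  also have "\<dots> =
      fps_nth (fps_of_poly (\<Prod>i=1..\<rho>. 1 - monom (1::int) i) * small_colors_gf b \<rho> \<rho>) m"
    by (simp add: fps_mult_nth T_def)
  also have "fps_of_poly (\<Prod>i=1..\<rho>. 1 - monom (1::int) i) = (\<Prod>i=1..\<rho>. 1 - fps_X ^ i)"
    by (simp add: fps_of_poly_prod fps_of_poly_diff fps_of_poly_monom)
  also have "\<dots> * small_colors_gf b \<rho> \<rho> = small_colors_gf b \<rho> 0"
    using assms by (rule prod_mult_gf) simp
  finally show ?thesis by (simp add: small_colors_gf_def)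
qed

theorem proposition6p16:
  fixes b \<rho> n :: nat
  assumes "b \<ge> 2" and "\<rho> \<ge> 1"
  shows "(\<Sum>j=0..\<rho> * (\<rho> + 1) div 2. T \<rho> j * int (Cbar b \<rho> (int b * int n - int j)))
           = int (Cbar b \<rho> (int n))
       \<and> (\<forall>r::nat. 1 \<le> r \<and> r \<le> b - 1 \<longrightarrow>
            (\<Sum>j=0..\<rho> * (\<rho> + 1) div 2.
               T \<rho> j * int (Cbar b \<rho> (int b * int n + int r - int j))) = 0)"
proof (intro conjI allI impI)
  show "(\<Sum>j=0..\<rho> * (\<rho> + 1) div 2. T \<rho> j * int (Cbar b \<rho> (int b * int n - int j)))
           = int (Cbar b \<rho> (int n))"
    using sum_T_Cbar[OF assms(1), of \<rho> "b * n"] card_small_colors_0_mult[OF assms(1), of \<rho> n]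
    by (simp add: Cbar_def)
next
  fix r :: nat
  assume r: "1 \<le> r \<and> r \<le> b - 1"
  then have "\<not> b dvd b * n + r"
    using assms(1) by (auto simp: dvd_add_right_iff dest: dvd_imp_le)
  then show "(\<Sum>j=0..\<rho> * (\<rho> + 1) div 2.
               T \<rho> j * int (Cbar b \<rho> (int b * int n + int r - int j))) = 0"
    using sum_T_Cbar[OF assms(1), of \<rho> "b * n + r"] small_colors_0_not_dvd[of b "b * n + r" \<rho>]
    by simp
qed

end
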